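(* Let $q>p>1$ be relatively prime integers. Then, as $n\to\infty$, $$f_{p,q}(n)=2^{\frac{(\log n)^2}{2\log p\log q}\left(1+O\left(\frac{\log\log n}{\log n}\right)\right)},$$ i.e. there is a constant $C=C(p,q)>0$ such that for all sufficiently large $n$ one has $f_{p,q}(n)=2^{\frac{(\log n)^2}{2\log p\log q}(1+E(n))}$ with $|E(n)|\le C\log\log n/\log n$.
   Context: $\mathbb{N}$ denotes the set of nonnegative integers. For relatively prime integers $p,q>1$, $f_{p,q}(n)$ denotes the number of different expressions of the positive integer $n$ as a sum of distinct terms taken from $\{p^{\alpha}q^{\beta}:\alpha,\beta\in\mathbb{N}\}$ (i.e. the number of finite subsets of this set whose elements sum to $n$). *)

theory Defs
  imports Complex_Main
begin

definition pq_terms :: "nat \<Rightarrow> nat \<Rightarrow> nat set" where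
  "pq_terms p q = {p ^ \<alpha> * q ^ \<beta> | \<alpha> \<beta>. True}"

definition num_reps :: "nat \<Rightarrow> nat \<Rightarrow> nat \<Rightarrow> nat" where
  "num_reps p q n = card {S. finite S \<and> S \<subseteq> pq_terms p q \<and> \<Sum>S = n}"

lemma finite_reps:
  "finite {S. finite S \<and> S \<subseteq> pq_terms p q \<and> \<Sum>S = n}"
proof (rule finite_subset)
  show "{S. finite S \<and> S \<subseteq> pq_terms p q \<and> \<Sum>S = n} \<subseteq> Pow {..n}"
    by (auto simp: member_le_sum[where f = "\<lambda>x. x"])
qed simp

end

theory Submission
  imports Defs "HOL-Number_Theory.Number_Theory" "HOL-Real_Asymp.Real_Asymp"
begin

text \<open>
  The upper bound is \<open>2 ^ m\<close>, where \<open>m\<close> counts the terms up to \<open>n\<close>. For the lower bound, a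
  strengthening of Birch's theorem provides \<open>K\<close> such that every large integer is a sum of distinct
  \<open>p ^ a * q ^ b\<close> with \<open>b \<le> K\<close>. Any set of terms with \<open>b > K\<close> that are at most \<open>n / (ln n)\<^sup>3\<close>
  has sum \<open>o(n)\<close>, so it can be completed to a representation of \<open>n\<close> by terms with \<open>b \<le> K\<close>.

  For Birch's theorem, the subset sums of the \<open>p - 1\<close> rows \<open>1 \<le> b < p\<close> have bounded gaps. In the
  other rows consider the group of integers \<open>d\<close> that are differences of two disjoint subset sums
  of arbitrarily large terms. It is nonzero: such sums meet all \<open>p ^ k\<close> residues modulo \<open>p ^ k\<close> while
  being \<open>O(p ^ k)\<close>, so two of them are close. Being nonzero, it contains a power of \<open>p\<close> and a power
  of \<open>q\<close>, hence \<open>1\<close>. Many disjoint representations of \<open>1\<close> as a difference then fill the gaps.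
\<close>

section \<open>Subset sums of sets of natural numbers\<close>

text \<open>\<open>d\<close> is fixed before \<open>N\<close>, so a member is represented beyond
  every bound and therefore by infinitely many mutually disjoint pairs. This makes the set a
  subgroup of the integers, and the disjointness of \<open>X\<close> and \<open>Y\<close> lets
  either one be exchanged for the other inside a larger sum.\<close>

definition tail_diffs :: "nat set \<Rightarrow> int set" where
  "tail_diffs R = {d. \<forall>N. \<exists>X Y. finite X \<and> finite Y \<and> X \<inter> Y = {} \<and> X \<union> Y \<subseteq> R \<inter> {N<..}
     \<and> int (\<Sum>X) - int (\<Sum>Y) = d}"

lemma tail_diffsE:
  assumes "d \<in> tail_diffs R"
  obtains X Y where "finite X" "finite Y" "X \<inter> Y = {}" "X \<subseteq> R \<inter> {N<..}" "Y \<subseteq> R \<inter> {N<..}"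
    "int (\<Sum>X) - int (\<Sum>Y) = d"
proof -
  have "\<exists>X Y. finite X \<and> finite Y \<and> X \<inter> Y = {} \<and> X \<union> Y \<subseteq> R \<inter> {N<..}
     \<and> int (\<Sum>X) - int (\<Sum>Y) = d"
    using assms unfolding tail_diffs_def by (simp only: mem_Collect_eq)
  then show thesis
    using that unfolding Un_subset_iff by (elim exE conjE)
qed

lemma tail_diffs_0: "0 \<in> tail_diffs R"
  unfolding tail_diffs_def by (auto intro!: exI[of _ "{}"])

lemma tail_diffs_uminus:
  assumes "d \<in> tail_diffs R"
  shows "- d \<in> tail_diffs R"
  unfolding tail_diffs_def
proof safe
  fix N
  obtain X Y where "finite X" "finite Y" "X \<inter> Y = {}" "X \<subseteq> R \<inter> {N<..}" "Y \<subseteq> R \<inter> {N<..}"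
    "int (\<Sum>X) - int (\<Sum>Y) = d"
    by (rule tail_diffsE[OF assms, where N = N])
  then have "finite Y \<and> finite X \<and> Y \<inter> X = {} \<and> Y \<union> X \<subseteq> R \<inter> {N<..}
     \<and> int (\<Sum>Y) - int (\<Sum>X) = - d"
    by (simp add: Int_commute del: of_nat_sum)
  then show "\<exists>X Y. finite X \<and> finite Y \<and> X \<inter> Y = {} \<and> X \<union> Y \<subseteq> R \<inter> {N<..}
     \<and> int (\<Sum>X) - int (\<Sum>Y) = - d"
    by (intro exI)
qed

text \<open>The pair for \<open>e\<close> is chosen beyond every element of the pair for
  \<open>d\<close>. All four sets are then disjoint and the sums simply add.\<close>

lemma tail_diffs_add:
  assumes "d \<in> tail_diffs R" "e \<in> tail_diffs R"
  shows "d + e \<in> tail_diffs R"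
  unfolding tail_diffs_def
proof safe
  fix N
  obtain X Y where XY: "finite X" "finite Y" "X \<inter> Y = {}" "X \<subseteq> R \<inter> {N<..}" "Y \<subseteq> R \<inter> {N<..}"
    "int (\<Sum>X) - int (\<Sum>Y) = d"
    by (rule tail_diffsE[OF assms(1), where N = N])
  define M where "M = Max (insert N (X \<union> Y))"
  have M: "N \<le> M" "\<And>x. x \<in> X \<union> Y \<Longrightarrow> x \<le> M"
    using XY by (auto simp: M_def)
  obtain X' Y' where XY': "finite X'" "finite Y'" "X' \<inter> Y' = {}" "X' \<subseteq> R \<inter> {M<..}" "Y' \<subseteq> R \<inter> {M<..}"
    "int (\<Sum>X') - int (\<Sum>Y') = e"
    by (rule tail_diffsE[OF assms(2), where N = M])
  have disj: "(X \<union> Y) \<inter> (X' \<union> Y') = {}"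
    using M(2) XY'(4,5) by fastforce
  have sub: "R \<inter> {M<..} \<subseteq> R \<inter> {N<..}" using M(1) by auto
  show "\<exists>X Y. finite X \<and> finite Y \<and> X \<inter> Y = {} \<and> X \<union> Y \<subseteq> R \<inter> {N<..}
     \<and> int (\<Sum>X) - int (\<Sum>Y) = d + e"
  proof (intro exI conjI)
    show "X \<union> X' \<union> (Y \<union> Y') \<subseteq> R \<inter> {N<..}"
      using XY(4,5) subset_trans[OF XY'(4) sub] subset_trans[OF XY'(5) sub] by simp
    have "\<Sum>(X \<union> X') = \<Sum>X + \<Sum>X'" "\<Sum>(Y \<union> Y') = \<Sum>Y + \<Sum>Y'"
      using XY(1,2) XY'(1,2) disj by (auto intro!: sum.union_disjoint)
    then show "int (\<Sum>(X \<union> X')) - int (\<Sum>(Y \<union> Y')) = d + e"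
      using XY(6) XY'(6) by linarith
    show "(X \<union> X') \<inter> (Y \<union> Y') = {}" using XY(3) XY'(3) disj by blast
  qed (use XY(1,2) XY'(1,2) in auto)
qed

lemma tail_diffs_mult:
  assumes "d \<in> tail_diffs R"
  shows "k * d \<in> tail_diffs R"
proof -
  have nat: "int m * d \<in> tail_diffs R" for m
    by (induction m) (auto simp: tail_diffs_0 algebra_simps intro!: tail_diffs_add assms)
  show ?thesis
  proof (cases "k \<ge> 0")
    case True
    then show ?thesis using nat[of "nat k"] by simp
  next
    case False
    then show ?thesis using tail_diffs_uminus[OF nat[of "nat (- k)"]] by simp
  qed
qed

lemma one_in_tail_diffs:
  assumes "int a \<in> tail_diffs R" "int b \<in> tail_diffs R" "coprime a b"
  shows "1 \<in> tail_diffs R"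
proof -
  have "coprime (int a) (int b)" using assms(3) by simp
  then obtain u v where "u * int a + v * int b = 1"
    by (metis bezout_int coprime_imp_gcd_eq_1)
  then show ?thesis using tail_diffs_add[OF tail_diffs_mult[OF assms(1)] tail_diffs_mult[OF assms(2)]]
    by metis
qed

text \<open>If infinitely many \<open>t i\<close> share a residue modulo \<open>d\<close>, then one of them equals an arbitrarily
  large other one minus a multiple of \<open>d\<close>.\<close>

lemma member_in_tail_diffs:
  fixes t :: "nat \<Rightarrow> nat"
  assumes d: "d \<in> tail_diffs R" "d \<noteq> 0" and t: "inj t" "range t \<subseteq> R"
  shows "\<exists>i. int (t i) \<in> tail_diffs R"
proof -
  let ?f = "\<lambda>i. int (t i) mod \<bar>d\<bar>"
  have "finite (range ?f)"
    by (rule finite_subset[of _ "{0..<\<bar>d\<bar>}"]) (use d(2) in auto)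
  then obtain i where i: "infinite {j. ?f j = ?f i}"
    using pigeonhole_infinite[of UNIV ?f] infinite_UNIV_nat by auto
  have "int (t i) \<in> tail_diffs R"
    unfolding tail_diffs_def
  proof safe
    fix N
    have "infinite (t ` {j. ?f j = ?f i})"
      using i t(1) by (metis finite_imageD inj_on_subset subset_UNIV)
    then obtain j where j: "?f j = ?f i" "t j > N"
      unfolding infinite_nat_iff_unbounded by blast
    have "d dvd int (t i) - int (t j)"
      using j(1) by (metis abs_dvd_iff mod_eq_dvd_iff)
    then obtain k where k: "int (t i) - int (t j) = k * d" by (metis dvd_def mult.commute)
    \<comment> \<open>Cutting at \<open>t j\<close> instead of \<open>N\<close> keeps
      \<open>t j\<close> out of both sets, so it can be added to \<open>X\<close> as a new
      element.\<close>
    obtain X Y where XY: "finite X" "finite Y" "X \<inter> Y = {}" "X \<subseteq> R \<inter> {t j<..}" "Y \<subseteq> R \<inter> {t j<..}"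
      "int (\<Sum>X) - int (\<Sum>Y) = k * d"
      by (rule tail_diffsE[OF tail_diffs_mult[OF d(1), of k], where N = "t j"])
    have nin: "t j \<notin> X" "t j \<notin> Y" using XY(4,5) by auto
    have sub: "R \<inter> {t j<..} \<subseteq> R \<inter> {N<..}" using j(2) by auto
    have "t j \<in> R" using t(2) by auto
    show "\<exists>X Y. finite X \<and> finite Y \<and> X \<inter> Y = {} \<and> X \<union> Y \<subseteq> R \<inter> {N<..}
     \<and> int (\<Sum>X) - int (\<Sum>Y) = int (t i)"
    proof (intro exI conjI)
      show "insert (t j) X \<union> Y \<subseteq> R \<inter> {N<..}"
        using j(2) \<open>t j \<in> R\<close> subset_trans[OF XY(4) sub] subset_trans[OF XY(5) sub] by simp
      have "\<Sum>(insert (t j) X) = t j + \<Sum>X" using XY(1) nin(1) by simp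
      then show "int (\<Sum>(insert (t j) X)) - int (\<Sum>Y) = int (t i)" using XY(6) k by linarith
    qed (use XY(1-3) nin(2) in auto)
  qed
  then show ?thesis ..
qed

text \<open>The bound \<open>M\<close> does not depend on \<open>N\<close>, so only the finitely
  many values 1 to \<open>M\<close> compete. If each of them failed beyond some threshold, all would
  fail beyond the largest threshold; yet a close pair there, with its common elements removed,
  realises one of them as a disjoint difference.\<close>

lemma tail_diffs_nonzero:
  assumes close: "\<And>N. \<exists>Z Z'. finite Z \<and> finite Z' \<and> Z \<subseteq> R \<inter> {N<..} \<and> Z' \<subseteq> R \<inter> {N<..}
    \<and> \<Sum>Z < \<Sum>Z' \<and> \<Sum>Z' \<le> \<Sum>Z + M"
  shows "\<exists>d\<in>tail_diffs R. d \<noteq> 0"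
proof (rule ccontr)
  assume contra: "\<not> ?thesis"
  let ?P = "\<lambda>d N. \<exists>X Y. finite X \<and> finite Y \<and> X \<inter> Y = {} \<and> X \<union> Y \<subseteq> R \<inter> {N<..}
     \<and> int (\<Sum>X) - int (\<Sum>Y) = d"
  have "\<exists>N. \<not> ?P d N" if "d \<in> {1..int M}" for d
  proof -
    have "d \<notin> tail_diffs R" using contra that by (metis atLeastAtMost_iff not_one_le_zero)
    then show ?thesis unfolding tail_diffs_def by (simp only: mem_Collect_eq not_all)
  qed
  then obtain f where f: "\<not> ?P d (f d)" if "d \<in> {1..int M}" for d by metis
  define N where "N = Max (insert 0 (f ` {1..int M}))"
  obtain Z Z' where Z: "finite Z" "finite Z'" "Z \<subseteq> R \<inter> {N<..}" "Z' \<subseteq> R \<inter> {N<..}"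
    "\<Sum>Z < \<Sum>Z'" "\<Sum>Z' \<le> \<Sum>Z + M" using close[of N] by (elim exE conjE)
  define d where "d = int (\<Sum>Z') - int (\<Sum>Z)"
  have d: "d \<in> {1..int M}" using Z(5,6) unfolding d_def atLeastAtMost_iff by linarith
  then have "f d \<le> N" by (auto simp: N_def)
  then have sub: "R \<inter> {N<..} \<subseteq> R \<inter> {f d<..}" by auto
  have "\<Sum>Z' = \<Sum>(Z' - Z) + \<Sum>(Z' \<inter> Z)" "\<Sum>Z = \<Sum>(Z - Z') + \<Sum>(Z' \<inter> Z)"
    using Z(1,2) sum.Int_Diff[of Z' id Z] sum.Int_Diff[of Z id Z'] by (simp_all add: Int_commute)
  then have "int (\<Sum>(Z' - Z)) - int (\<Sum>(Z - Z')) = d" unfolding d_def by linarith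
  moreover have "(Z' - Z) \<union> (Z - Z') \<subseteq> R \<inter> {f d<..}"
    using subset_trans[OF Z(3) sub] subset_trans[OF Z(4) sub] by blast
  moreover have "finite (Z' - Z)" "finite (Z - Z')" "(Z' - Z) \<inter> (Z - Z') = {}"
    using Z(1,2) by auto
  ultimately have "?P d (f d)" by (intro exI conjI)
  with f[OF d] show False by contradiction
qed

text \<open>Each induction step adds a fresh pair with sum of \<open>U\<close> equal to sum of
  \<open>V\<close> plus 1. Adjoining \<open>V\<close> shifts the old interval as a whole, and
  adjoining \<open>U\<close> to the set for the top value reaches one further.\<close>

lemma tail_diffs_interval:
  assumes "1 \<in> tail_diffs R"
  shows "\<exists>W Y. finite W \<and> W \<subseteq> R \<and> (\<forall>r\<le>D. \<exists>Z\<subseteq>W. \<Sum>Z = Y + r)"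
proof (induction D)
  case 0
  show ?case by (intro exI[of _ "{}"] exI[of _ 0]) auto
next
  case (Suc D)
  then obtain W Y where W: "finite W" "W \<subseteq> R" "\<And>r. r \<le> D \<Longrightarrow> \<exists>Z\<subseteq>W. \<Sum>Z = Y + r" by blast
  \<comment> \<open>Sets beyond \<open>M\<close> are disjoint from \<open>W\<close>; the inserted 0
    covers the case of empty \<open>W\<close>.\<close>
  define M where "M = Max (insert 0 W)"
  have M: "x \<le> M" if "x \<in> W" for x using that W(1) by (auto simp: M_def)
  obtain U V where UV: "finite U" "finite V" "U \<inter> V = {}" "U \<subseteq> R \<inter> {M<..}" "V \<subseteq> R \<inter> {M<..}"
    "int (\<Sum>U) - int (\<Sum>V) = 1"
    by (rule tail_diffsE[OF assms, where N = M])
  have disj: "W \<inter> U = {}" "W \<inter> V = {}"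
    using M UV(4,5) by fastforce+
  have "\<forall>r\<le>Suc D. \<exists>Z\<subseteq>W \<union> U \<union> V. \<Sum>Z = Y + \<Sum>V + r"
  proof (intro allI impI)
    fix r assume r: "r \<le> Suc D"
    show "\<exists>Z\<subseteq>W \<union> U \<union> V. \<Sum>Z = Y + \<Sum>V + r"
    proof (cases "r \<le> D")
      case True
      with W(3) obtain Z where Z: "Z \<subseteq> W" "\<Sum>Z = Y + r" by blast
      have "\<Sum>(Z \<union> V) = \<Sum>Z + \<Sum>V"
        by (rule sum.union_disjoint) (use Z W UV disj in \<open>auto intro: finite_subset\<close>)
      with Z show ?thesis by (intro exI[of _ "Z \<union> V"]) auto
    next
      case False
      from W(3)[of D] obtain Z where Z: "Z \<subseteq> W" "\<Sum>Z = Y + D" by blast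
      have "\<Sum>(Z \<union> U) = \<Sum>Z + \<Sum>U"
        by (rule sum.union_disjoint) (use Z W UV disj in \<open>auto intro: finite_subset\<close>)
      moreover have "\<Sum>U = \<Sum>V + 1" using UV(6) by linarith
      ultimately show ?thesis using Z False r by (intro exI[of _ "Z \<union> U"]) auto
    qed
  qed
  moreover have "W \<union> U \<union> V \<subseteq> R" using W(2) UV(4,5) by simp
  moreover have "finite (W \<union> U \<union> V)" using W(1) UV(1,2) by simp
  ultimately show ?case by (intro exI conjI)
qed

section \<open>Greedy approximation by subset sums\<close>

text \<open>Greedy choice from the top: if the elements below \<open>x\<close> already come within
  \<open>D\<close> of \<open>n\<close>, then \<open>x\<close> is omitted. Otherwise the growth
  condition on \<open>B\<close> forces \<open>x \<le> n\<close>, and it remains to approximate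
  \<open>n - x\<close> by the smaller elements.\<close>

lemma subset_sums_gap:
  fixes B :: "nat set"
  assumes B: "\<And>x. x \<in> B \<Longrightarrow> x \<le> \<Sum>(B \<inter> {..<x}) + D"
    and n: "n < \<Sum>(B \<inter> {..<x}) + D"
  shows "\<exists>Z\<subseteq>B \<inter> {..<x}. \<Sum>Z \<le> n \<and> n < \<Sum>Z + D"
  using n
proof (induction x arbitrary: n)
  case 0
  then show ?case by auto
next
  case (Suc x)
  show ?case
  proof (cases "x \<in> B")
    case False
    then have "B \<inter> {..<Suc x} = B \<inter> {..<x}" by (auto simp: less_Suc_eq)
    with Suc show ?thesis by simp
  next
    case True
    then have eq: "B \<inter> {..<Suc x} = insert x (B \<inter> {..<x})" by (auto simp: less_Suc_eq)
    show ?thesis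
    proof (cases "n < \<Sum>(B \<inter> {..<x}) + D")
      case True
      from Suc.IH[OF this] show ?thesis unfolding eq by blast
    next
      case False
      with B[OF \<open>x \<in> B\<close>] have "x \<le> n" by linarith
      moreover have "n - x < \<Sum>(B \<inter> {..<x}) + D"
        using Suc.prems \<open>x \<le> n\<close> unfolding eq by simp
      from Suc.IH[OF this] obtain Z where Z: "Z \<subseteq> B \<inter> {..<x}" "\<Sum>Z \<le> n - x" "n - x < \<Sum>Z + D"
        by blast
      moreover have "\<Sum>(insert x Z) = x + \<Sum>Z"
        by (rule sum.insert) (use Z in \<open>auto intro: finite_subset[of _ "{..<x}"]\<close>)
      ultimately show ?thesis unfolding eq
        by (intro exI[of _ "insert x Z"]) auto
    qed
  qed
qed

section \<open>Birch's theorem with bounded exponent of one base\<close>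

locale coprime_bases =
  fixes p q :: nat
  assumes p_gt_1: "1 < p" and q_gt_1: "1 < q" and coprime_p_q: "coprime p q"
begin

lemma pq_power_eq_iff: "p ^ a * q ^ b = p ^ c * q ^ d \<longleftrightarrow> a = c \<and> b = d"
proof
  have le: "c \<le> a" if "p ^ a * q ^ b = p ^ c * q ^ d" for a b c d
  proof (rule ccontr)
    assume "\<not> c \<le> a"
    then obtain e where e: "c = Suc (a + e)" by (metis less_iff_Suc_add not_le)
    with that have "p ^ a * q ^ b = p ^ a * (p * p ^ e * q ^ d)"
      by (simp add: power_add algebra_simps)
    then have "q ^ b = p * p ^ e * q ^ d" using p_gt_1 by simp
    then have "p dvd q ^ b" by simp
    moreover have "coprime p (q ^ b)" using coprime_p_q by simp
    ultimately show False using p_gt_1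
      by (metis coprime_common_divisor_nat dvd_refl less_not_refl)
  qed
  assume eq: "p ^ a * q ^ b = p ^ c * q ^ d"
  then have "a = c" using le[OF eq] le[OF eq[symmetric]] by simp
  with eq show "a = c \<and> b = d" using p_gt_1 q_gt_1 by simp
qed auto

section \<open>Rows of terms with a fixed exponent of q\<close>

definition row :: "nat \<Rightarrow> nat set" where
  "row b = range (\<lambda>a. p ^ a * q ^ b)"

definition rows :: "nat set \<Rightarrow> nat set" where
  "rows J = (\<Union>b\<in>J. row b)"

lemma in_rows_iff [simp]: "p ^ a * q ^ b \<in> rows J \<longleftrightarrow> b \<in> J"
  unfolding rows_def row_def by (auto simp: pq_power_eq_iff)

lemma rowsE:
  assumes "x \<in> rows J"
  obtains a b where "x = p ^ a * q ^ b" "b \<in> J"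
  using assms unfolding rows_def row_def by auto

lemma rows_mono: "I \<subseteq> J \<Longrightarrow> rows I \<subseteq> rows J"
  by (auto simp: rows_def)

lemma rows_disjoint: "I \<inter> J = {} \<Longrightarrow> rows I \<inter> rows J = {}"
  by (auto elim!: rowsE simp: pq_power_eq_iff)

text \<open>Let \<open>i\<close> be least with \<open>x \<le> p ^ i * q ^ b\<close>. The terms with
  smaller exponent of \<open>p\<close> lie below \<open>x\<close>, and their geometric sum times
  \<open>p - 1\<close> is \<open>p ^ i * q ^ b - q ^ b\<close>. A single row thus covers about the
  fraction \<open>1 / (p - 1)\<close> of \<open>x\<close>.\<close>

lemma row_sum_ge: "x \<le> (p - 1) * \<Sum>(row b \<inter> {..<x}) + q ^ b"
proof -
  have geo: "(p - 1) * (\<Sum>j<i. p ^ j) + 1 = p ^ i" for i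
  proof (induction i)
    case (Suc i)
    have "(p - 1) * p ^ i + p ^ i = p * p ^ i"
      using p_gt_1 by (simp add: algebra_simps diff_mult_distrib)
    with Suc show ?case by (simp add: algebra_simps)
  qed simp
  have "x \<le> p ^ x" using p_gt_1 by (simp add: less_imp_le power_gt_expt)
  also have "\<dots> \<le> p ^ x * q ^ b" using q_gt_1 by simp
  finally have ex: "\<exists>i. x \<le> p ^ i * q ^ b" ..
  define i where "i = (LEAST i. x \<le> p ^ i * q ^ b)"
  have i: "x \<le> p ^ i * q ^ b" unfolding i_def using ex by (rule LeastI_ex)
  have "p ^ j * q ^ b < x" if "j < i" for j
    using not_less_Least[of j "\<lambda>i. x \<le> p ^ i * q ^ b"] that unfolding i_def by simp
  then have sub: "(\<lambda>j. p ^ j * q ^ b) ` {..<i} \<subseteq> row b \<inter> {..<x}"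
    by (auto simp: row_def)
  have "p ^ i * q ^ b = (p - 1) * ((\<Sum>j<i. p ^ j) * q ^ b) + q ^ b"
    unfolding geo[of i, symmetric] by (simp only: distrib_right mult_1 mult.assoc)
  also have "(\<Sum>j<i. p ^ j) * q ^ b = \<Sum>((\<lambda>j. p ^ j * q ^ b) ` {..<i})"
    using p_gt_1 q_gt_1 by (subst sum.reindex) (auto simp: inj_on_def sum_distrib_right)
  also have "\<dots> \<le> \<Sum>(row b \<inter> {..<x})"
    by (rule sum_mono2) (use sub in auto)
  finally show ?thesis using i by simp
qed

text \<open>Adding the estimate over \<open>p - 1\<close> rows compensates the factor
  \<open>p - 1\<close> lost in each, which explains the number of rows set aside. The result is the
  growth condition for the greedy choice, with \<open>D = q ^ p\<close>.\<close>

lemma low_rows_sum_ge: "x \<le> \<Sum>(rows {1..<p} \<inter> {..<x}) + q ^ p"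
proof -
  have "\<Sum>(rows {1..<p} \<inter> {..<x}) = \<Sum>(\<Union>b\<in>{1..<p}. row b \<inter> {..<x})"
    by (simp add: rows_def)
  also have "\<dots> = (\<Sum>b\<in>{1..<p}. \<Sum>(row b \<inter> {..<x}))"
    by (rule sum.UNION_disjoint) (auto simp: row_def pq_power_eq_iff)
  finally have eq: "\<Sum>(rows {1..<p} \<inter> {..<x}) = (\<Sum>b\<in>{1..<p}. \<Sum>(row b \<inter> {..<x}))" .
  have "x \<le> (p - 1) * \<Sum>(row b \<inter> {..<x}) + q ^ p" if "b \<in> {1..<p}" for b
  proof -
    have "q ^ b \<le> q ^ p" using that q_gt_1 by (intro power_increasing) auto
    with row_sum_ge[of x b] show ?thesis by linarith
  qed
  then have "(\<Sum>b\<in>{1..<p}. x) \<le> (\<Sum>b\<in>{1..<p}. (p - 1) * \<Sum>(row b \<inter> {..<x}) + q ^ p)"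
    by (rule sum_mono)
  then have "(p - 1) * x \<le> (p - 1) * (\<Sum>(rows {1..<p} \<inter> {..<x}) + q ^ p)"
    unfolding eq by (simp add: sum.distrib sum_distrib_left algebra_simps)
  then show ?thesis using p_gt_1 by simp
qed

lemma low_rows_gap:
  "\<exists>Z. finite Z \<and> Z \<subseteq> rows {1..<p} \<and> \<Sum>Z \<le> n \<and> n < \<Sum>Z + q ^ p"
proof -
  have "n < \<Sum>(rows {1..<p} \<inter> {..<Suc n}) + q ^ p"
    using low_rows_sum_ge[of "Suc n"] by linarith
  from subset_sums_gap[OF low_rows_sum_ge this]
  obtain Z where Z: "Z \<subseteq> rows {1..<p} \<inter> {..<Suc n}" "\<Sum>Z \<le> n" "n < \<Sum>Z + q ^ p" by blast
  then have "finite Z" by (meson finite_Int finite_lessThan finite_subset)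
  with Z show ?thesis by blast
qed

section \<open>Small sums in every residue class modulo powers of p\<close>

text \<open>By Euler's theorem each of these powers of \<open>q\<close> is 1 modulo
  \<open>p\<close>, so \<open>d\<close> of them act as the base-\<open>p\<close> digit
  \<open>d\<close>. The offset \<open>h\<close> leaves room to make the exponents large.\<close>

lemma digit_cong: "[(\<Sum>l<d. q ^ (totient p * (h + l))) = d] (mod p)"
proof -
  have "[q ^ totient p = 1] (mod p)"
    using coprime_p_q by (intro euler_theorem) (simp add: coprime_commute)
  then have "[q ^ (totient p * m) = 1] (mod p)" for m
    using cong_pow[of "q ^ totient p" 1 p m] by (simp add: power_mult)
  then have "[(\<Sum>l<d. q ^ (totient p * (h + l))) = (\<Sum>l<d. 1)] (mod p)"
    by (intro cong_sum)
  then show ?thesis by simp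
qed

text \<open>The bound on the sum involves \<open>N\<close> only through the additive constant \<open>C\<close>, since
  in high positions \<open>p ^ i\<close> alone exceeds \<open>N\<close>.\<close>

lemma residues_by_sums:
  "\<exists>C. \<forall>k m. \<exists>Z. finite Z \<and> Z \<subseteq> rows {p..} \<inter> {N<..} \<and> [\<Sum>Z = m] (mod p ^ k)
     \<and> \<Sum>Z \<le> C + p * q ^ (totient p * (p + p)) * p ^ k"
proof -
  define t where "t = totient p"
  have t: "t > 0" using p_gt_1 by (simp add: t_def)
  \<comment> \<open>For \<open>k < N\<close> the power of \<open>q\<close> itself has to exceed
    \<open>N\<close>. For \<open>k \<ge> N\<close> the factor \<open>p ^ k\<close> does so, and the
    offset \<open>p\<close> suffices to stay in the rows from \<open>p\<close> on, at a cost
    independent of \<open>N\<close>.\<close>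
  define h where "h k = (if k < N then N + p else p)" for k
  define D where "D k d = (\<lambda>l. p ^ k * q ^ (t * (h k + l))) ` {..<d}" for k d
  define S where "S r = p * q ^ (t * (r + p))" for r
  have S: "(\<Sum>l<d. q ^ (t * (r + l))) \<le> S r" if "d < p" for r d
  proof -
    have "(\<Sum>l<d. q ^ (t * (r + l))) \<le> (\<Sum>l<d. q ^ (t * (r + p)))"
      using that q_gt_1 by (intro sum_mono power_increasing mult_le_mono) auto
    also have "\<dots> \<le> S r" using that by (simp add: S_def)
    finally show ?thesis .
  qed
  have sumD: "\<Sum>(D k d) = p ^ k * (\<Sum>l<d. q ^ (t * (h k + l)))" for k d
  proof -
    have "inj_on (\<lambda>l. p ^ k * q ^ (t * (h k + l))) {..<d}"
      unfolding inj_on_def pq_power_eq_iff using t by simp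
    then show ?thesis unfolding D_def by (simp add: sum.reindex sum_distrib_left)
  qed
  have D_sub: "D k d \<subseteq> rows {p..} \<inter> {N<..}" for k d
  proof
    fix x assume "x \<in> D k d"
    then obtain l where x: "x = p ^ k * q ^ (t * (h k + l))" by (auto simp: D_def)
    have ge: "h k \<le> t * (h k + l)"
      using t by (metis le_add1 le_trans mult_le_mono1 nat_mult_1 Suc_leI One_nat_def)
    have "p \<le> h k" by (simp add: h_def)
    moreover have "N < x"
    proof (cases "k < N")
      case True
      have "N < q ^ N" using q_gt_1 by (simp add: power_gt_expt)
      also have "\<dots> \<le> q ^ (t * (h k + l))"
        using ge True q_gt_1 by (intro power_increasing) (auto simp: h_def)
      also have "\<dots> \<le> x" using p_gt_1 by (simp add: x)
      finally show ?thesis .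
    next
      case False
      have "k < p ^ k" using p_gt_1 by (simp add: power_gt_expt)
      also have "\<dots> \<le> x" using q_gt_1 by (simp add: x)
      finally show ?thesis using False by simp
    qed
    ultimately show "x \<in> rows {p..} \<inter> {N<..}"
      using ge by (simp add: x)
  qed
  \<comment> \<open>The condition \<open>i < k\<close> makes the next block, with exponent
    \<open>k\<close> of \<open>p\<close>, disjoint from \<open>Z\<close>. The term with
    \<open>min k N\<close> collects the expensive low positions and stops growing at
    \<open>k = N\<close>.\<close>
  have main: "\<exists>Z. finite Z \<and> Z \<subseteq> rows {p..} \<inter> {N<..} \<and> Z \<subseteq> {p ^ i * q ^ j |i j. i < k}
      \<and> [\<Sum>Z = m] (mod p ^ k) \<and> \<Sum>Z \<le> S (N + p) * p ^ min k N + S p * p ^ k" for k m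
  proof (induction k)
    case 0
    show ?case by (intro exI[of _ "{}"]) (auto simp: cong_def)
  next
    case (Suc k)
    then obtain Z where Z: "finite Z" "Z \<subseteq> rows {p..} \<inter> {N<..}" "Z \<subseteq> {p ^ i * q ^ j |i j. i < k}"
      "[\<Sum>Z = m] (mod p ^ k)" "\<Sum>Z \<le> S (N + p) * p ^ min k N + S p * p ^ k"
      by (elim exE conjE)
    from Z(4) have "[int m = int (\<Sum>Z)] (mod int p ^ k)"
      by (metis cong_int_iff cong_sym of_nat_power)
    then obtain e where e: "int m = int (\<Sum>Z) + int p ^ k * e"
      by (metis cong_iff_lin cong_sym)
    \<comment> \<open>\<open>d\<close> is the next base-\<open>p\<close> digit to be corrected. The
      quotient \<open>e\<close> may be negative, hence the detour through integers.\<close>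
    define d where "d = nat (e mod int p)"
    have d: "d < p" "[e = int d] (mod int p)"
      using p_gt_1 by (auto simp: d_def nat_less_iff)
    have disj: "Z \<inter> D k d = {}"
    proof -
      have "x \<notin> D k d" if "x \<in> Z" for x
        using subsetD[OF Z(3) that] by (auto simp: D_def pq_power_eq_iff)
      then show ?thesis by blast
    qed
    have sum_un: "\<Sum>(Z \<union> D k d) = \<Sum>Z + \<Sum>(D k d)"
      by (rule sum.union_disjoint) (use Z(1) disj in \<open>auto simp: D_def\<close>)
    show ?case
    proof (intro exI conjI)
      show "finite (Z \<union> D k d)" using Z(1) by (simp add: D_def)
      show "Z \<union> D k d \<subseteq> rows {p..} \<inter> {N<..}" using Z(2) D_sub by (rule Un_least)
      show "Z \<union> D k d \<subseteq> {p ^ i * q ^ j |i j. i < Suc k}"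
      proof (rule Un_least)
        show "Z \<subseteq> {p ^ i * q ^ j |i j. i < Suc k}"
          using Z(3) by (rule subset_trans) (auto intro: less_SucI)
        show "D k d \<subseteq> {p ^ i * q ^ j |i j. i < Suc k}" by (auto simp: D_def)
      qed
      have "[int (\<Sum>l<d. q ^ (t * (h k + l))) = int d] (mod int p)"
        using digit_cong[of "h k" d] by (simp only: cong_int_iff t_def)
      then have "[int (\<Sum>l<d. q ^ (t * (h k + l))) = e] (mod int p)"
        using d(2) cong_sym cong_trans by blast
      then have "[int p ^ k * int (\<Sum>l<d. q ^ (t * (h k + l))) = int p ^ k * e] (mod (int p ^ k * int p))"
        using p_gt_1 by (intro cong_cmult_leftI)
      then have "[int (\<Sum>(D k d)) = int p ^ k * e] (mod (int p ^ Suc k))"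
        unfolding sumD by (simp only: of_nat_mult of_nat_power power_Suc2)
      then have "[int (\<Sum>Z) + int (\<Sum>(D k d)) = int (\<Sum>Z) + int p ^ k * e] (mod (int p ^ Suc k))"
        by (intro cong_add cong_refl)
      then have "[int (\<Sum>(Z \<union> D k d)) = int m] (mod (int (p ^ Suc k)))"
        unfolding sum_un e by (simp only: of_nat_add of_nat_power)
      then show "[\<Sum>(Z \<union> D k d) = m] (mod p ^ Suc k)" by (simp only: cong_int_iff)
      \<comment> \<open>Since \<open>p \<ge> 2\<close>, multiplying a bound by \<open>p\<close>
        leaves room for adding one more block of the same size.\<close>
      have two: "a + a \<le> a * p" for a :: nat using p_gt_1
        by (metis mult.commute mult_2 mult_le_mono1 Suc_leI Suc_1)
      have "\<Sum>(D k d) \<le> p ^ k * S (h k)"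
        unfolding sumD using S[OF d(1)] by (rule mult_le_mono2)
      moreover have "S (N + p) * p ^ min k N + S p * p ^ k + p ^ k * S (h k)
          \<le> S (N + p) * p ^ min (Suc k) N + S p * p ^ Suc k"
      proof (cases "k < N")
        case True
        then show ?thesis
          using two[of "S (N + p) * p ^ k"] two[of "S p * p ^ k"]
          by (simp add: h_def algebra_simps)
      next
        case False
        then have "min k N = N" "min (Suc k) N = N" by simp_all
        then show ?thesis
          using two[of "S p * p ^ k"] False by (simp add: h_def algebra_simps)
      qed
      ultimately show "\<Sum>(Z \<union> D k d) \<le> S (N + p) * p ^ min (Suc k) N + S p * p ^ Suc k"
        unfolding sum_un using Z(5) by linarith
    qed
  qed
  show ?thesis
  proof (intro exI[of _ "S (N + p) * p ^ N"] allI)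
    fix k m
    obtain Z where Z: "finite Z" "Z \<subseteq> rows {p..} \<inter> {N<..}"
      "[\<Sum>Z = m] (mod p ^ k)" "\<Sum>Z \<le> S (N + p) * p ^ min k N + S p * p ^ k"
      using main[of k m] by (elim exE conjE)
    have "S (N + p) * p ^ min k N \<le> S (N + p) * p ^ N"
      using p_gt_1 by (intro mult_le_mono2 power_increasing) auto
    with Z(4) have "\<Sum>Z \<le> S (N + p) * p ^ N + p * q ^ (totient p * (p + p)) * p ^ k"
      unfolding S_def t_def by linarith
    with Z(1-3) show "\<exists>Z. finite Z \<and> Z \<subseteq> rows {p..} \<inter> {N<..} \<and> [\<Sum>Z = m] (mod p ^ k)
     \<and> \<Sum>Z \<le> S (N + p) * p ^ N + p * q ^ (totient p * (p + p)) * p ^ k"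
      by (intro exI conjI)
  qed
qed

text \<open>Pigeonhole: the \<open>p ^ k\<close> residue classes have representatives of size at
  most \<open>(S + 1) * p ^ k\<close>, which occupy at most \<open>p ^ k div 2 + 1\<close> boxes of
  length \<open>M = 2 * (S + 1)\<close>. Two representatives share a box, and they differ because
  they are incongruent.\<close>

lemma close_sums:
  defines "M \<equiv> 2 * (p * q ^ (totient p * (p + p)) + 1)"
  shows "\<exists>Z Z'. finite Z \<and> finite Z' \<and> Z \<subseteq> rows {p..} \<inter> {N<..} \<and> Z' \<subseteq> rows {p..} \<inter> {N<..}
    \<and> \<Sum>Z < \<Sum>Z' \<and> \<Sum>Z' \<le> \<Sum>Z + M"
proof -
  define S where "S = p * q ^ (totient p * (p + p))"
  obtain C where C: "\<And>k m. \<exists>Z. finite Z \<and> Z \<subseteq> rows {p..} \<inter> {N<..} \<and> [\<Sum>Z = m] (mod p ^ k)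
     \<and> \<Sum>Z \<le> C + S * p ^ k"
    using residues_by_sums[of N] unfolding S_def by blast
  \<comment> \<open>Large enough for \<open>p ^ k\<close> to absorb \<open>C\<close>, and above 2 so
    that there are fewer boxes than classes.\<close>
  define k where "k = C + 2"
  have "k < p ^ k" using p_gt_1 by (simp add: power_gt_expt)
  then have k: "C \<le> p ^ k" "2 < p ^ k" by (auto simp: k_def)
  obtain g where g: "\<And>m. finite (g m)" "\<And>m. g m \<subseteq> rows {p..} \<inter> {N<..}"
    "\<And>m. [\<Sum>(g m) = m] (mod p ^ k)" "\<And>m. \<Sum>(g m) \<le> C + S * p ^ k"
    using C[where k = k] by metis
  have M: "M = 2 * (S + 1)" by (simp add: M_def S_def)
  have "\<Sum>(g m) div M \<le> p ^ k div 2" for m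
  proof -
    have "\<Sum>(g m) \<le> (S + 1) * p ^ k" using g(4)[of m] k(1) by simp
    then have "\<Sum>(g m) div M \<le> ((S + 1) * p ^ k) div M" by (rule div_le_mono)
    also have "\<dots> = p ^ k div 2" unfolding M by (simp only: mult.commute[of 2] div_mult_mult1)
    finally show ?thesis .
  qed
  then have "(\<lambda>m. \<Sum>(g m) div M) ` {..<p ^ k} \<subseteq> {..p ^ k div 2}" by auto
  then have "card ((\<lambda>m. \<Sum>(g m) div M) ` {..<p ^ k}) \<le> card {..p ^ k div 2}"
    by (intro card_mono) auto
  also have "\<dots> < card {..<p ^ k}" using k(2) by simp
  finally have "\<not> inj_on (\<lambda>m. \<Sum>(g m) div M) {..<p ^ k}" by (rule pigeonhole)
  then obtain m m' where m: "m < p ^ k" "m' < p ^ k" "m \<noteq> m'" "\<Sum>(g m) div M = \<Sum>(g m') div M"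
    unfolding inj_on_def by auto
  have ne: "\<Sum>(g m) \<noteq> \<Sum>(g m')"
    using g(3)[of m] g(3)[of m'] m(1-3) by (metis cong_less_modulus_unique_nat cong_sym cong_trans)
  have near: "x \<le> y + M" if "x div M = y div M" for x y :: nat
  proof -
    have "x = M * (x div M) + x mod M" "y = M * (y div M) + y mod M" by simp_all
    moreover have "x mod M < M" by (simp add: M)
    ultimately show ?thesis using that by (metis add.commute add_le_mono le_add1 less_imp_le)
  qed
  show ?thesis
  proof (cases "\<Sum>(g m) < \<Sum>(g m')")
    case True
    show ?thesis by (intro exI conjI) (rule g True near m(4)[symmetric])+
  next
    case False
    with ne have "\<Sum>(g m') < \<Sum>(g m)" by simp
    then show ?thesis by (intro exI conjI) (rule g \<open>\<Sum>(g m') < \<Sum>(g m)\<close> near m(4))+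
  qed
qed

section \<open>The difference 1 and Birch's theorem\<close>

text \<open>The close sums come from the rows from \<open>p\<close> on, where the powers of
  \<open>q\<close> are also found. Row 0 belongs to the complement of the low rows and supplies the
  powers of \<open>p\<close>; coprimality of the two powers then gives 1.\<close>

lemma one_in_tail_diffs_rows: "1 \<in> tail_diffs (rows (- {1..<p}))"
proof -
  let ?R = "rows (- {1..<p})"
  have "rows {p..} \<subseteq> ?R" by (rule rows_mono) auto
  then have sub: "rows {p..} \<inter> {N<..} \<subseteq> ?R \<inter> {N<..}" for N by blast
  have "\<exists>d\<in>tail_diffs ?R. d \<noteq> 0"
  proof (rule tail_diffs_nonzero)
    fix N
    obtain Z Z' where Z: "finite Z" "finite Z'" "Z \<subseteq> rows {p..} \<inter> {N<..}" "Z' \<subseteq> rows {p..} \<inter> {N<..}"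
      "\<Sum>Z < \<Sum>Z'" "\<Sum>Z' \<le> \<Sum>Z + 2 * (p * q ^ (totient p * (p + p)) + 1)"
      using close_sums[of N] by (elim exE conjE)
    then show "\<exists>Z Z'. finite Z \<and> finite Z' \<and> Z \<subseteq> ?R \<inter> {N<..} \<and> Z' \<subseteq> ?R \<inter> {N<..}
      \<and> \<Sum>Z < \<Sum>Z' \<and> \<Sum>Z' \<le> \<Sum>Z + 2 * (p * q ^ (totient p * (p + p)) + 1)"
      using subset_trans[OF Z(3) sub] subset_trans[OF Z(4) sub] by (intro exI conjI)
  qed
  then obtain d where d: "d \<in> tail_diffs ?R" "d \<noteq> 0" by blast
  have "inj (\<lambda>a. p ^ a * q ^ 0)" "range (\<lambda>a. p ^ a * q ^ 0) \<subseteq> ?R"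
    unfolding inj_on_def pq_power_eq_iff image_subset_iff in_rows_iff by auto
  from member_in_tail_diffs[OF d this] obtain a where a: "int (p ^ a) \<in> tail_diffs ?R" by auto
  have "inj (\<lambda>b. p ^ 0 * q ^ (p + b))" "range (\<lambda>b. p ^ 0 * q ^ (p + b)) \<subseteq> ?R"
    unfolding inj_on_def pq_power_eq_iff image_subset_iff in_rows_iff by auto
  from member_in_tail_diffs[OF d this] obtain b where b: "int (q ^ (p + b)) \<in> tail_diffs ?R" by auto
  show ?thesis by (rule one_in_tail_diffs[OF a b]) (use coprime_p_q in simp)
qed

text \<open>The low rows approximate \<open>n - Y\<close> from below with error less than
  \<open>q ^ p\<close>, and a subset of \<open>W\<close> contributes \<open>Y\<close> plus exactly
  this error. The low rows have exponents of \<open>q\<close> below \<open>p\<close> and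
  \<open>W\<close> is finite, so a single \<open>K\<close> bounds all exponents of
  \<open>q\<close>.\<close>

theorem birch_bounded_rows:
  "\<exists>K N. \<forall>n\<ge>N. \<exists>Z. finite Z \<and> Z \<subseteq> rows {..K} \<and> \<Sum>Z = n"
proof -
  obtain W Y where W: "finite W" "W \<subseteq> rows (- {1..<p})" "\<forall>r\<le>q ^ p. \<exists>Z\<subseteq>W. \<Sum>Z = Y + r"
    using tail_diffs_interval[OF one_in_tail_diffs_rows, where D = "q ^ p"] by (elim exE conjE)
  have "\<forall>x\<in>W. \<exists>b. x \<in> row b" using W(2) by (auto simp: rows_def)
  then obtain f where f: "\<And>x. x \<in> W \<Longrightarrow> x \<in> row (f x)" by metis
  define K where "K = Max (insert p (f ` W))"
  have K: "p \<le> K" "\<And>x. x \<in> W \<Longrightarrow> f x \<le> K" using W(1) by (auto simp: K_def)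
  have WK: "W \<subseteq> rows {..K}" using f K(2) by (auto simp: rows_def)
  have lowK: "rows {1..<p} \<subseteq> rows {..K}" using K(1) by (intro rows_mono) auto
  have disj: "rows {1..<p} \<inter> W = {}" using W(2) rows_disjoint[of "{1..<p}" "- {1..<p}"] by auto
  have "\<exists>Z. finite Z \<and> Z \<subseteq> rows {..K} \<and> \<Sum>Z = n" if "n \<ge> Y" for n
  proof -
    obtain Z where Z: "finite Z" "Z \<subseteq> rows {1..<p}" "\<Sum>Z \<le> n - Y" "n - Y < \<Sum>Z + q ^ p"
      using low_rows_gap by blast
    then have "n - Y - \<Sum>Z \<le> q ^ p" by linarith
    with W(3) obtain V where V: "V \<subseteq> W" "\<Sum>V = Y + (n - Y - \<Sum>Z)" by blast
    have "\<Sum>(Z \<union> V) = \<Sum>Z + \<Sum>V"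
      by (rule sum.union_disjoint) (use Z V W(1) disj in \<open>auto intro: finite_subset\<close>)
    with V Z(3) that have "\<Sum>(Z \<union> V) = n" by linarith
    moreover have "finite (Z \<union> V)" using Z(1) V(1) W(1) by (simp add: finite_subset)
    moreover have "Z \<union> V \<subseteq> rows {..K}" using Z(2) V(1) WK lowK by blast
    ultimately show ?thesis by blast
  qed
  then show ?thesis by blast
qed

end

section \<open>Counting terms and representations\<close>

text \<open>With \<open>\<alpha> = ln p\<close>, \<open>\<beta> = ln q\<close> and
  \<open>L = ln x\<close> these are the exponent pairs of the terms up to \<open>x\<close>; the
  triangle has area \<open>L\<^sup>2 / (2 * \<alpha> * \<beta>)\<close>.\<close>

definition lattice_triangle :: "real \<Rightarrow> real \<Rightarrow> real \<Rightarrow> (nat \<times> nat) set" where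
  "lattice_triangle \<alpha> \<beta> L = {(a, b). real a * \<alpha> + real b * \<beta> \<le> L}"

lemma Collect_mult_le_eq:
  assumes "\<alpha> > 0" "y \<ge> 0"
  shows "{a :: nat. real a * \<alpha> \<le> y} = {..nat \<lfloor>y / \<alpha>\<rfloor>}"
  using assms by (auto simp: le_nat_iff le_floor_iff pos_le_divide_eq)

text \<open>The points are counted line by line: for fixed \<open>b\<close> their number lies
  between \<open>(L - b * \<beta>) / \<alpha>\<close> and that value plus 1, and these linear
  expressions are summed in closed form.\<close>

lemma lattice_triangle_count:
  assumes \<alpha>: "\<alpha> > 0" and \<beta>: "\<beta> > 0" and L: "L \<ge> 0"
  shows "finite (lattice_triangle \<alpha> \<beta> L)"
    and "L\<^sup>2 / (2 * \<alpha> * \<beta>) \<le> card (lattice_triangle \<alpha> \<beta> L)"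
    and "card (lattice_triangle \<alpha> \<beta> L) \<le> (L + \<alpha> + \<beta>)\<^sup>2 / (2 * \<alpha> * \<beta>)"
proof -
  define B where "B = nat \<lfloor>L / \<beta>\<rfloor>"
  define F where "F b = {a :: nat. real a * \<alpha> \<le> L - real b * \<beta>}" for b
  have B: "{b :: nat. real b * \<beta> \<le> L} = {..B}"
    unfolding B_def using \<beta> L by (rule Collect_mult_le_eq)
  have "real B * \<beta> \<le> L" using B by blast
  moreover have "L < real (Suc B) * \<beta>" using B by (metis Suc_n_not_le_n atMost_iff mem_Collect_eq not_le)
  \<comment> \<open>\<open>\<theta>\<close> is the fractional part of \<open>L / \<beta>\<close>.
    Expressed through \<open>B\<close> and \<open>\<theta>\<close>, both estimates become polynomial
    identities with a visibly nonnegative remainder.\<close>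
  ultimately obtain \<theta> where \<theta>: "L = \<beta> * (real B + \<theta>)" "0 \<le> \<theta>" "\<theta> < 1"
    using \<beta> by (intro that[of "L / \<beta> - real B"]) (auto simp: field_simps)
  have y: "L - real b * \<beta> \<ge> 0" if "b \<le> B" for b using B that by auto
  have F: "finite (F b)" "(L - real b * \<beta>) / \<alpha> \<le> card (F b)" "card (F b) \<le> (L - real b * \<beta>) / \<alpha> + 1"
    if "b \<le> B" for b
  proof -
    have eq: "F b = {..nat \<lfloor>(L - real b * \<beta>) / \<alpha>\<rfloor>}"
      unfolding F_def using \<alpha> y[OF that] by (rule Collect_mult_le_eq)
    have "(L - real b * \<beta>) / \<alpha> \<ge> 0" using y[OF that] \<alpha> by simp
    then have "real (nat \<lfloor>(L - real b * \<beta>) / \<alpha>\<rfloor>) \<le> (L - real b * \<beta>) / \<alpha>"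
      "(L - real b * \<beta>) / \<alpha> \<le> real (nat \<lfloor>(L - real b * \<beta>) / \<alpha>\<rfloor>) + 1"
      by linarith+
    then show "finite (F b)" "(L - real b * \<beta>) / \<alpha> \<le> card (F b)"
      "card (F b) \<le> (L - real b * \<beta>) / \<alpha> + 1"
      unfolding eq card_atMost of_nat_Suc by (simp, linarith+)
  qed
  have eq: "lattice_triangle \<alpha> \<beta> L = prod.swap ` (SIGMA b:{..B}. F b)"
  proof -
    have "b \<le> B" if "real a * \<alpha> + real b * \<beta> \<le> L" for a b :: nat
    proof -
      have "real a * \<alpha> \<ge> 0" using \<alpha> by simp
      with that have "real b * \<beta> \<le> L" by linarith
      then show ?thesis using B by blast
    qed
    then show ?thesis unfolding lattice_triangle_def F_def by (force simp: image_iff)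
  qed
  show "finite (lattice_triangle \<alpha> \<beta> L)" unfolding eq using F(1) by auto
  have card: "real (card (lattice_triangle \<alpha> \<beta> L)) = (\<Sum>b\<le>B. real (card (F b)))"
    unfolding eq using F(1) by (simp add: card_image card_SigmaI)
  have gauss: "(\<Sum>b\<le>B. (L - real b * \<beta>) / \<alpha>) = (real B + 1) * (L - \<beta> * real B / 2) / \<alpha>"
  proof -
    have "(\<Sum>b\<le>m. real b) = real m * (real m + 1) / 2" for m
      by (induction m) (auto simp: field_simps)
    then have "(\<Sum>b\<le>B. L - real b * \<beta>) = (real B + 1) * (L - \<beta> * real B / 2)"
      by (simp add: sum_subtractf flip: sum_distrib_right) (simp add: field_simps)
    then show ?thesis by (simp flip: sum_divide_distrib)
  qed
  have "L\<^sup>2 / (2 * \<beta>) \<le> (real B + 1) * (L - \<beta> * real B / 2)"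
  proof -
    have "(real B + 1) * (L - \<beta> * real B / 2) - L\<^sup>2 / (2 * \<beta>)
        = \<beta> * (real B + \<theta> * (2 - \<theta>)) / 2"
      unfolding \<theta>(1) using \<beta> by (simp add: field_simps power2_eq_square)
    moreover have "\<beta> * (real B + \<theta> * (2 - \<theta>)) / 2 \<ge> 0" using \<beta> \<theta> by simp
    ultimately show ?thesis by linarith
  qed
  then have "L\<^sup>2 / (2 * \<beta>) / \<alpha> \<le> (real B + 1) * (L - \<beta> * real B / 2) / \<alpha>"
    using \<alpha> by (intro divide_right_mono) auto
  also have "\<dots> \<le> card (lattice_triangle \<alpha> \<beta> L)"
    unfolding card gauss[symmetric] using F(2) by (intro sum_mono) auto
  finally show "L\<^sup>2 / (2 * \<alpha> * \<beta>) \<le> card (lattice_triangle \<alpha> \<beta> L)" by (simp add: mult_ac)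
  have "card (lattice_triangle \<alpha> \<beta> L) \<le> (\<Sum>b\<le>B. (L - real b * \<beta>) / \<alpha> + 1)"
    unfolding card using F(3) by (intro sum_mono) auto
  also have "\<dots> = (real B + 1) * (L - \<beta> * real B / 2) / \<alpha> + (real B + 1)"
    unfolding sum.distrib gauss by simp
  also have "\<dots> \<le> (L + \<alpha> + \<beta>)\<^sup>2 / (2 * \<alpha> * \<beta>)"
  proof -
    have "(L + \<alpha> + \<beta>)\<^sup>2 - 2 * \<alpha> * \<beta> * ((real B + 1) * (L - \<beta> * real B / 2) / \<alpha> + (real B + 1))
        = (\<alpha> + \<beta> * \<theta>)\<^sup>2 + \<beta>\<^sup>2 * (real B + 1)"
      unfolding \<theta>(1) using \<alpha> by (simp add: field_simps power2_eq_square)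
    moreover have "\<dots> \<ge> 0" by simp
    ultimately have "2 * \<alpha> * \<beta> * ((real B + 1) * (L - \<beta> * real B / 2) / \<alpha> + (real B + 1))
        \<le> (L + \<alpha> + \<beta>)\<^sup>2" by linarith
    moreover have "2 * \<alpha> * \<beta> > 0" using \<alpha> \<beta> by simp
    ultimately show ?thesis by (simp only: pos_le_divide_eq mult.commute)
  qed
  finally show "card (lattice_triangle \<alpha> \<beta> L) \<le> (L + \<alpha> + \<beta>)\<^sup>2 / (2 * \<alpha> * \<beta>)" .
qed

section \<open>Upper and lower bounds for the number of representations\<close>

context coprime_bases
begin

lemma pq_power_le_iff:
  assumes "x > 0"
  shows "real (p ^ a * q ^ b) \<le> x \<longleftrightarrow> (a, b) \<in> lattice_triangle (ln p) (ln q) (ln x)"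
proof -
  have "ln (real (p ^ a * q ^ b)) = real a * ln p + real b * ln q"
    using p_gt_1 q_gt_1 by (simp add: ln_mult ln_realpow)
  moreover have "real (p ^ a * q ^ b) > 0" using p_gt_1 q_gt_1 by simp
  ultimately show ?thesis using assms by (simp add: lattice_triangle_def flip: ln_le_cancel_iff)
qed

lemma ln_p_pos: "ln (real p) > 0" and ln_q_pos: "ln (real q) > 0"
  using p_gt_1 q_gt_1 by auto

lemma pq_terms_le_eq:
  assumes "x > 0"
  shows "{t \<in> pq_terms p q. real t \<le> x} =
    (\<lambda>(a, b). p ^ a * q ^ b) ` lattice_triangle (ln p) (ln q) (ln x)"
  unfolding pq_terms_def using pq_power_le_iff[OF assms] by force

lemma pq_terms_le_card:
  assumes "x \<ge> 1"
  shows "finite {t \<in> pq_terms p q. real t \<le> x}"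
    and "card {t \<in> pq_terms p q. real t \<le> x} \<le> (ln x + ln p + ln q)\<^sup>2 / (2 * ln p * ln q)"
proof -
  have "x > 0" "ln x \<ge> 0" using assms by auto
  note T = lattice_triangle_count[OF ln_p_pos ln_q_pos this(2)]
  show "finite {t \<in> pq_terms p q. real t \<le> x}"
    unfolding pq_terms_le_eq[OF \<open>x > 0\<close>] using T(1) by simp
  have "card {t \<in> pq_terms p q. real t \<le> x} \<le> card (lattice_triangle (ln p) (ln q) (ln x))"
    unfolding pq_terms_le_eq[OF \<open>x > 0\<close>] using T(1) by (rule card_image_le)
  with T(3) show "card {t \<in> pq_terms p q. real t \<le> x} \<le> (ln x + ln p + ln q)\<^sup>2 / (2 * ln p * ln q)"
    by linarith
qed

lemma num_reps_le:
  assumes "n \<ge> 1"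
  shows "real (num_reps p q n) \<le> 2 powr ((ln n + ln p + ln q)\<^sup>2 / (2 * ln p * ln q))"
proof -
  let ?T = "{t \<in> pq_terms p q. real t \<le> real n}"
  have T: "finite ?T" "card ?T \<le> (ln n + ln p + ln q)\<^sup>2 / (2 * ln p * ln q)"
    using assms pq_terms_le_card[of "real n"] by auto
  have "{S. finite S \<and> S \<subseteq> pq_terms p q \<and> \<Sum>S = n} \<subseteq> Pow ?T"
    by (auto simp: member_le_sum[where f = "\<lambda>x. x"])
  then have "num_reps p q n \<le> card (Pow ?T)"
    unfolding num_reps_def using T(1) by (intro card_mono) auto
  also have "\<dots> = 2 ^ card ?T" using T(1) by (rule card_Pow)
  finally have "real (num_reps p q n) \<le> 2 ^ card ?T"
    by (metis of_nat_le_iff of_nat_numeral of_nat_power)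
  also have "\<dots> = 2 powr card ?T" by (simp add: powr_realpow)
  also have "\<dots> \<le> 2 powr ((ln n + ln p + ln q)\<^sup>2 / (2 * ln p * ln q))"
    using T(2) by (intro powr_mono) auto
  finally show ?thesis .
qed

lemma rows_subset_pq_terms: "rows J \<subseteq> pq_terms p q"
  unfolding pq_terms_def by (auto elim!: rowsE)

text \<open>Every subset \<open>U\<close> of \<open>G\<close> leaves a remainder of at least
  \<open>N\<close>, which the rows up to \<open>K\<close> can represent. Intersecting the resulting
  set with the rows above \<open>K\<close> recovers \<open>U\<close>, so distinct subsets give
  distinct representations.\<close>

lemma num_reps_ge:
  assumes birch: "\<And>n. n \<ge> N \<Longrightarrow> \<exists>Z. finite Z \<and> Z \<subseteq> rows {..K} \<and> \<Sum>Z = n"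
    and G: "finite G" "G \<subseteq> rows {K<..}" "\<Sum>G + N \<le> n"
  shows "2 ^ card G \<le> num_reps p q n"
proof -
  have "\<exists>Z. finite Z \<and> Z \<subseteq> rows {..K} \<and> \<Sum>Z = n - \<Sum>U" if "U \<in> Pow G" for U
  proof -
    have "\<Sum>U \<le> \<Sum>G" using that G(1) by (intro sum_mono2) auto
    with G(3) show ?thesis by (intro birch) linarith
  qed
  then obtain Z where Z: "\<And>U. U \<in> Pow G \<Longrightarrow> finite (Z U)" "\<And>U. U \<in> Pow G \<Longrightarrow> Z U \<subseteq> rows {..K}"
    "\<And>U. U \<in> Pow G \<Longrightarrow> \<Sum>(Z U) = n - \<Sum>U" by metis
  have disj: "rows {K<..} \<inter> rows {..K} = {}" by (rule rows_disjoint) auto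
  have "inj_on (\<lambda>U. U \<union> Z U) (Pow G)"
  proof (rule inj_on_inverseI)
    fix U assume "U \<in> Pow G"
    then show "(U \<union> Z U) \<inter> rows {K<..} = U" using Z(2)[of U] G(2) disj by blast
  qed
  moreover have "(\<lambda>U. U \<union> Z U) ` Pow G \<subseteq> {S. finite S \<and> S \<subseteq> pq_terms p q \<and> \<Sum>S = n}"
  proof (rule image_subsetI, unfold mem_Collect_eq, intro conjI)
    fix U assume "U \<in> Pow G"
    then have U: "U \<subseteq> G" by simp
    have fin: "finite U" using U G(1) by (rule finite_subset)
    show "finite (U \<union> Z U)" using fin Z(1) U by simp
    have "\<Sum>U \<le> \<Sum>G" using U G(1) by (intro sum_mono2) auto
    moreover have "\<Sum>(U \<union> Z U) = \<Sum>U + \<Sum>(Z U)"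
      by (rule sum.union_disjoint) (use fin Z(1,2)[of U] U G(2) disj in auto)
    ultimately show "\<Sum>(U \<union> Z U) = n" using Z(3)[of U] U G(3) by simp
    show "U \<union> Z U \<subseteq> pq_terms p q"
      using U G(2) Z(2)[of U] rows_subset_pq_terms by blast
  qed
  ultimately have "card (Pow G) \<le> num_reps p q n"
    unfolding num_reps_def using finite_reps by (rule card_inj_on_le)
  then show ?thesis using G(1) by (simp add: card_Pow)
qed

lemma num_reps_ge_powr:
  fixes K N n :: nat
  assumes birch: "\<And>n. n \<ge> N \<Longrightarrow> \<exists>Z. finite Z \<and> Z \<subseteq> rows {..K} \<and> \<Sum>Z = n"
    and x: "ln x \<ge> (real K + 1) * ln q" "x > 0"
    and n: "(ln x + ln p + ln q)\<^sup>2 / (2 * ln p * ln q) * x + N \<le> n"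
  shows "2 powr ((ln x - (real K + 1) * ln q)\<^sup>2 / (2 * ln p * ln q)) \<le> real (num_reps p q n)"
proof -
  let ?T = "{t \<in> pq_terms p q. real t \<le> x}"
  define L where "L = ln x - (real K + 1) * ln q"
  have L: "L \<ge> 0" using x(1) by (simp add: L_def)
  note T = lattice_triangle_count[OF ln_p_pos ln_q_pos L]
  \<comment> \<open>The triangle is shifted by \<open>K + 1\<close> rows to reach exponents of
    \<open>q\<close> above \<open>K\<close>. The additional factor \<open>q ^ (K + 1)\<close> is
    what reduces \<open>ln x\<close> to \<open>L\<close>.\<close>
  define G where "G = (\<lambda>(a, b). p ^ a * q ^ (K + 1 + b)) ` lattice_triangle (ln p) (ln q) L"
  have "0 \<le> (real K + 1) * ln q" using ln_q_pos by simp
  with x have "x \<ge> 1" by (metis ln_ge_zero_iff order_trans)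
  have finG: "finite G" using T(1) by (simp add: G_def)
  have cardG: "card G = card (lattice_triangle (ln p) (ln q) L)"
    unfolding G_def by (rule card_image) (auto simp: inj_on_def pq_power_eq_iff simp del: mult_cancel1 power_Suc)
  have G_le: "real t \<le> x" if "t \<in> G" for t
  proof -
    from that obtain a b where t: "t = p ^ a * q ^ (K + 1 + b)" "(a, b) \<in> lattice_triangle (ln p) (ln q) L"
      by (auto simp: G_def)
    then show ?thesis unfolding t(1) pq_power_le_iff[OF x(2)]
      by (simp add: lattice_triangle_def L_def algebra_simps)
  qed
  have G_rows: "G \<subseteq> rows {K<..}"
    unfolding G_def image_subset_iff by (simp only: split: prod.split) (simp only: in_rows_iff, simp)
  have "G \<subseteq> ?T" using G_le G_rows rows_subset_pq_terms by blast
  then have "card G \<le> card ?T" by (intro card_mono pq_terms_le_card \<open>x \<ge> 1\<close>)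
  then have "card G \<le> (ln x + ln p + ln q)\<^sup>2 / (2 * ln p * ln q)"
    using pq_terms_le_card(2)[OF \<open>x \<ge> 1\<close>] by linarith
  moreover have "real (\<Sum>G) \<le> card G * x"
    using sum_bounded_above[of G real x] G_le by simp
  ultimately have "real (\<Sum>G) + N \<le> n"
    using n x(2) mult_right_mono[of "real (card G)" _ x] by fastforce
  then have "\<Sum>G + N \<le> n" by linarith
  with birch finG G_rows have "2 ^ card G \<le> num_reps p q n" by (rule num_reps_ge)
  then have "2 ^ card G \<le> real (num_reps p q n)"
    by (metis of_nat_le_iff of_nat_numeral of_nat_power)
  moreover have "2 powr (L\<^sup>2 / (2 * ln p * ln q)) \<le> 2 powr card G"
    unfolding cardG using T(2) by (intro powr_mono) auto
  moreover have "2 powr card G = (2 :: real) ^ card G" by (simp add: powr_realpow)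
  ultimately show ?thesis unfolding L_def by linarith
qed

end

section \<open>From the two bounds to the asymptotic formula\<close>

theorem theorem1:
  fixes p q :: nat
  assumes "1 < p" and "p < q" and "coprime p q"
  shows "\<exists>C>0. \<exists>E :: nat \<Rightarrow> real. \<forall>\<^sub>F n in sequentially.
           real (num_reps p q n) =
             2 powr ((ln (real n))\<^sup>2 / (2 * ln (real p) * ln (real q)) * (1 + E n))
           \<and> \<bar>E n\<bar> \<le> C * ln (ln (real n)) / ln (real n)"
proof -
  interpret coprime_bases p q by standard (use assms in auto)
  obtain K N where birch: "\<And>n. n \<ge> N \<Longrightarrow> \<exists>Z. finite Z \<and> Z \<subseteq> rows {..K} \<and> \<Sum>Z = n"
    using birch_bounded_rows by metis
  define s where "s = ln (real p) + ln (real q)"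
  define c where "c = (real K + 1) * ln (real q)"
  define D where "D = 2 * ln (real p) * ln (real q)"
  have D: "D > 0" using ln_p_pos ln_q_pos by (simp add: D_def)
  define f where "f n = real (num_reps p q n)" for n
  \<comment> \<open>The required identity solved for the error term: it holds as soon as
    \<open>f n\<close> and \<open>ln n\<close> are positive, and only the size of \<open>E\<close>
    remains to be estimated.\<close>
  define E where "E n = log 2 (f n) * D / (ln (real n))\<^sup>2 - 1" for n
  \<comment> \<open>With \<open>x = n / (ln n)\<^sup>3\<close> the terms up to \<open>x\<close> have total sum \<open>o(n)\<close>.\<close>
  define x where "x n = real n / ln (real n) ^ 3" for n
  have "(\<lambda>n. (ln (x n) + s)\<^sup>2 * (1 / ln (real n) ^ 3)) \<longlonglongrightarrow> 0"
    unfolding x_def by real_asymp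
  from tendsto_add[OF tendsto_divide_zero[OF this, of D] lim_const_over_n[of "real N"]]
  have "(\<lambda>n. (ln (x n) + s)\<^sup>2 / D * (1 / ln (real n) ^ 3) + N / real n) \<longlonglongrightarrow> 0"
    by (simp add: mult.commute)
  then have ev1: "\<forall>\<^sub>F n in sequentially. (ln (x n) + s)\<^sup>2 / D * (1 / ln (real n) ^ 3) + N / real n < 1"
    by (rule order_tendstoD) simp
  have ev2: "\<forall>\<^sub>F n in sequentially. c \<le> ln (x n)"
    unfolding x_def by real_asymp
  have ev3: "\<forall>\<^sub>F n in sequentially. ln (real n) > 0" by real_asymp
  \<comment> \<open>Here \<open>ln (x n) = ln n - 3 * ln (ln n)\<close>, so squaring costs
    \<open>6 * ln (ln n) / ln n\<close> to leading order. The constant 7 absorbs the lower order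
    terms, and also the error of order \<open>1 / ln n\<close> in the upper bound.\<close>
  have ev4: "\<forall>\<^sub>F n in sequentially. - (7 * ln (ln (real n)) / ln (real n)) \<le> (ln (x n) - c)\<^sup>2 / (ln (real n))\<^sup>2 - 1"
    unfolding x_def by real_asymp
  have ev5: "\<forall>\<^sub>F n in sequentially. (ln (real n) + s)\<^sup>2 / (ln (real n))\<^sup>2 - 1 \<le> 7 * ln (ln (real n)) / ln (real n)"
    by real_asymp
  have "\<forall>\<^sub>F n in sequentially. f n = 2 powr ((ln (real n))\<^sup>2 / D * (1 + E n))
      \<and> \<bar>E n\<bar> \<le> 7 * ln (ln (real n)) / ln (real n)"
    using ev1 ev2 ev3 ev4 ev5 eventually_gt_at_top[of 0]
  proof eventually_elim
    case (elim n)
    let ?L = "ln (real n)"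
    have x: "x n > 0" using elim by (simp add: x_def)
    have "(ln (x n) + s)\<^sup>2 / D * x n + N \<le> n"
      using elim(1,6) elim(3) by (simp add: x_def field_simps)
    then have lo: "2 powr ((ln (x n) - c)\<^sup>2 / D) \<le> f n"
      using num_reps_ge_powr[of N K "x n" n, OF birch _ x] elim(2) by (simp add: s_def c_def D_def f_def add.assoc)
    have hi: "f n \<le> 2 powr ((?L + s)\<^sup>2 / D)"
      using num_reps_le[of n] elim(6) by (simp add: s_def D_def f_def add.assoc)
    have pos: "f n > 0" using lo by (rule less_le_trans[rotated]) simp
    have lo': "(ln (x n) - c)\<^sup>2 / D \<le> log 2 (f n)" using lo pos by (simp add: le_log_iff)
    have hi': "log 2 (f n) \<le> (?L + s)\<^sup>2 / D" using hi pos by (simp add: log_le_iff)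
    have "(ln (x n) - c)\<^sup>2 / ?L\<^sup>2 \<le> log 2 (f n) * D / ?L\<^sup>2"
      using lo' D by (intro divide_right_mono) (auto simp: field_simps)
    moreover have "log 2 (f n) * D / ?L\<^sup>2 \<le> (?L + s)\<^sup>2 / ?L\<^sup>2"
      using hi' D by (intro divide_right_mono) (auto simp: field_simps)
    ultimately have "\<bar>E n\<bar> \<le> 7 * ln ?L / ?L"
      unfolding E_def using elim(4,5) by linarith
    moreover have "?L\<^sup>2 / D * (1 + E n) = log 2 (f n)"
      using elim(3) D by (simp add: E_def)
    ultimately show ?case using pos by simp
  qed
  then show ?thesis unfolding f_def D_def by (intro exI[of _ 7] conjI exI[of _ E]) auto
qed

end
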